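(* Let $0<q<p\le1$, $k\in\mathbb{Z}$, $n\ge0$, and let $s$ be a nonnegative integer. Then $$E_{n,p,q}^{(k)}(x)=\sum_{l=0}^n\binom nl S_2(l+s,s)\sum_{i=0}^{n-l} \frac{\binom{n-l}{i}}{\binom{l+s}{s}}\, \mathfrak B_i^{(s)}(x)\, E_{n-l-i,p,q}^{(k)}.$$
   Context: $[n]_{p,q}=\frac{p^n-q^n}{p-q}$; $\mathrm{Li}_{k,p,q}(t)=\sum_{n\ge1} t^n/[n]_{p,q}^k$. The $(p,q)$-poly-Euler polynomials are defined by $\frac{2\,\mathrm{Li}_{k,p,q}(1-e^{-t})}{1+e^{t}}e^{xt}=\sum_{n\ge0} E_{n,p,q}^{(k)}(x)\frac{t^n}{n!}$, and $E_{n,p,q}^{(k)}:=E_{n,p,q}^{(k)}(0)$. The Stirling numbers of the second kind are defined by $\frac{(e^x-1)^m}{m!}=\sum_{n\ge m}S_2(n,m)\frac{x^n}{n!}$. The Bernoulli polynomials of order $s$ are defined by $\left(\frac{t}{e^t-1}\right)^s e^{xt}=\sum_{n\ge0}\mathfrak B_n^{(s)}(x)\frac{t^n}{n!}$. *)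

theory Defs
  imports
    "HOL-Computational_Algebra.Computational_Algebra"
    "HOL-Combinatorics.Combinatorics"
begin

text \<open>
  All generating functions are formal power series in \<open>t\<close>. The parameters \<open>p\<close>, \<open>q\<close> are real; the
  argument \<open>x\<close> ranges over an arbitrary real field (in particular the reals or the complex numbers).
\<close>

definition pq_number :: "real \<Rightarrow> real \<Rightarrow> nat \<Rightarrow> real" where
  "pq_number p q n = (p ^ n - q ^ n) / (p - q)"

definition pq_Li :: "int \<Rightarrow> real \<Rightarrow> real \<Rightarrow> 'a :: real_field fps" where
  "pq_Li k p q = Abs_fps (\<lambda>n. if n = 0 then 0 else 1 / of_real (pq_number p q n) powi k)"

definition pq_poly_Euler_gf :: "int \<Rightarrow> real \<Rightarrow> real \<Rightarrow> 'a :: real_field \<Rightarrow> 'a fps" where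
  "pq_poly_Euler_gf k p q x =
     2 * (pq_Li k p q oo (1 - fps_exp (-1))) / (1 + fps_exp 1) * fps_exp x"

definition pq_poly_Euler :: "int \<Rightarrow> real \<Rightarrow> real \<Rightarrow> nat \<Rightarrow> 'a :: real_field \<Rightarrow> 'a" where
  "pq_poly_Euler k p q n x = fact n * fps_nth (pq_poly_Euler_gf k p q x) n"

abbreviation pq_poly_Euler_number :: "int \<Rightarrow> real \<Rightarrow> real \<Rightarrow> nat \<Rightarrow> 'a :: real_field" where
  "pq_poly_Euler_number k p q n \<equiv> pq_poly_Euler k p q n 0"

text \<open>
  The series \<open>fps_exp 1 - 1\<close> has subdegree 1 and is not invertible, but division of formal
  power series cancels the common factor \<open>t\<close>, so the quotient below has constant term 1.
\<close>

definition bernoulli_order_gf :: "nat \<Rightarrow> 'a :: field_char_0 \<Rightarrow> 'a fps" where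
  "bernoulli_order_gf s x = (fps_X / (fps_exp 1 - 1)) ^ s * fps_exp x"

definition bernoulli_order :: "nat \<Rightarrow> nat \<Rightarrow> 'a :: field_char_0 \<Rightarrow> 'a" where
  "bernoulli_order s n x = fact n * fps_nth (bernoulli_order_gf s x) n"

lemma fps_X_div_fps_exp_minus_1:
  "fps_X / (fps_exp 1 - 1) * (fps_exp 1 - 1) = (fps_X :: 'a :: field_char_0 fps)"
proof -
  have "subdegree (fps_exp 1 - 1 :: 'a fps) = 1"
    by (rule subdegreeI) auto
  hence "(fps_exp 1 - 1 :: 'a fps) dvd fps_X"
    by (subst fps_dvd_iff) auto
  thus ?thesis by simp
qed

text \<open>
  The Stirling numbers \<open>S\<^sub>2(n,m)\<close> are the library's \<^const>\<open>Stirling\<close>, defined there by recurrence;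
  the following is their exponential generating function \<open>(e\<^sup>t - 1)\<^sup>m / m!\<close>.
\<close>

lemma Stirling_egf:
  "(fps_exp 1 - 1) ^ m / fps_const (fact m) =
     (Abs_fps (\<lambda>n. of_nat (Stirling n m) / fact n) :: 'a :: field_char_0 fps)"
proof -
  define F :: "nat \<Rightarrow> 'a fps" where "F = (\<lambda>m. fps_const (1 / fact m) * (fps_exp 1 - 1) ^ m)"
  have deriv: "fps_deriv (F (Suc m)) = of_nat (Suc m) * F (Suc m) + F m" for m
  proof -
    have c: "fps_const (1 / fact (Suc m)) * of_nat (Suc m) = (fps_const (1 / fact m) :: 'a fps)"
      by (simp add: fps_of_nat [symmetric] field_simps del: of_nat_Suc)
    have "fps_deriv (F (Suc m)) =
            (fps_const (1 / fact (Suc m)) * of_nat (Suc m)) * (fps_exp 1 * (fps_exp 1 - 1) ^ m)"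
      unfolding F_def by (simp add: fps_deriv_power fps_of_nat mult_ac del: of_nat_Suc fact_Suc power_Suc)
    also have "\<dots> = (fps_const (1 / fact (Suc m)) * of_nat (Suc m)) * (fps_exp 1 - 1) ^ Suc m + F m"
      unfolding c by (simp add: F_def algebra_simps)
    also have "\<dots> = of_nat (Suc m) * F (Suc m) + F m"
      unfolding F_def by (simp only: mult_ac)
    finally show ?thesis .
  qed
  have "fact n * fps_nth (F m) n = of_nat (Stirling n m)" for n m
  proof (induction n m rule: Stirling.induct)
    case (4 n k)
    have "fact (Suc n) * fps_nth (F (Suc k)) (Suc n) = fact n * fps_nth (fps_deriv (F (Suc k))) n"
      by (simp add: algebra_simps)
    also have "\<dots> = of_nat (Suc k) * (fact n * fps_nth (F (Suc k)) n) + fact n * fps_nth (F k) n"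
      unfolding deriv by (simp add: fps_of_nat [symmetric] algebra_simps del: of_nat_Suc)
    finally show ?case using 4 by (simp add: distrib_right)
  qed (auto simp: F_def)
  hence "F m = Abs_fps (\<lambda>n. of_nat (Stirling n m) / fact n)"
    by (intro fps_ext) (simp add: field_simps)
  thus ?thesis
    by (simp add: F_def fps_divide_unit fps_const_inverse mult.commute divide_inverse)
qed

end

theory Submission
  imports Defs
begin

text \<open>
  By the generating function of the Stirling numbers, the numbers
  \<open>S\<^sub>2(l+s,s) / binom(l+s,s)\<close> have exponential generating function \<open>((e\<^sup>t - 1) / t)\<^sup>s\<close>, which is
  inverse to \<open>(t / (e\<^sup>t - 1))\<^sup>s\<close>. Hence the generating function of the polynomials at \<open>x\<close> is the
  product of that series, the Bernoulli series \<open>(t / (e\<^sup>t - 1))\<^sup>s e\<^bsup>xt\<^esup>\<close>, and the generating function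
  at \<open>0\<close>; the identity compares coefficients.
\<close>

lemma fact_mult_fps_mult_nth:
  fixes f g :: "'a :: field_char_0 fps"
  shows "fact n * fps_nth (f * g) n =
    (\<Sum>i=0..n. of_nat (n choose i) * (fact i * fps_nth f i) * (fact (n - i) * fps_nth g (n - i)))"
  unfolding fps_mult_nth sum_distrib_left
  by (intro sum.cong refl) (simp add: binomial_fact field_simps)

definition Stirling_order_gf :: "nat \<Rightarrow> 'a :: field_char_0 fps" where
  "Stirling_order_gf s =
     Abs_fps (\<lambda>l. of_nat (Stirling (l + s) s) / of_nat ((l + s) choose s) / fact l)"

text \<open>Rests on \<open>fact s / fact (l + s) = 1 / (((l + s) choose s) * fact l)\<close>; the
  factor \<open>fps_X ^ s\<close> shifts the index by \<open>s\<close>.\<close>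

lemma fps_X_power_mult_Stirling_order_gf:
  "fps_X ^ s * Stirling_order_gf s = ((fps_exp 1 - 1) ^ s :: 'a :: field_char_0 fps)"
proof -
  define S :: "'a fps" where "S = Abs_fps (\<lambda>n. of_nat (Stirling n s) / fact n)"
  have "(fps_exp 1 - 1) ^ s = fps_const (fact s) * S"
    unfolding S_def Stirling_egf [symmetric] by (subst dvd_mult_div_cancel) (auto simp: fps_dvd_iff)
  moreover have "fps_X ^ s * Stirling_order_gf s = fps_const (fact s) * S"
  proof (rule fps_ext)
    fix n
    show "fps_nth (fps_X ^ s * Stirling_order_gf s) n = fps_nth (fps_const (fact s) * S) n"
    proof (cases "n < s")
      case False
      then have "s \<le> n" by simp
      then show ?thesis
        by (simp add: S_def Stirling_order_gf_def fps_X_power_mult_nth binomial_fact field_simps)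
    \<comment> \<open>For \<open>n < s\<close> both sides vanish, as
      \<open>Stirling n s = 0\<close>.\<close>
    qed (simp add: S_def fps_X_power_mult_nth)
  qed
  ultimately show ?thesis by simp
qed

lemma Stirling_order_gf_mult_bernoulli_order_gf:
  "Stirling_order_gf s * bernoulli_order_gf s x = fps_exp (x :: 'a :: field_char_0)"
proof -
  define B :: "'a fps" where "B = fps_X / (fps_exp 1 - 1)"
  have "fps_X ^ s * (Stirling_order_gf s * B ^ s) = (B * (fps_exp 1 - 1)) ^ s"
    by (simp only: mult.assoc [symmetric] fps_X_power_mult_Stirling_order_gf power_mult_distrib)
      (rule mult.commute)
  also have "\<dots> = fps_X ^ s * 1"
    unfolding B_def fps_X_div_fps_exp_minus_1 by simp
  \<comment> \<open>Power series over a field form an integral domain, so the nonzero factor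
    \<open>fps_X ^ s\<close> cancels.\<close>
  finally have "Stirling_order_gf s * B ^ s = 1"
    by (subst (asm) mult_cancel_left) simp
  then show ?thesis
    by (simp add: bernoulli_order_gf_def B_def flip: mult.assoc)
qed

text \<open>The argument enters the Euler series only through the factor
  \<open>fps_exp x\<close>.\<close>

lemma pq_poly_Euler_gf_decompose:
  "pq_poly_Euler_gf k p q x =
     Stirling_order_gf s * (bernoulli_order_gf s x * pq_poly_Euler_gf k p q 0)"
proof -
  have "pq_poly_Euler_gf k p q x = fps_exp x * pq_poly_Euler_gf k p q 0"
    by (simp add: pq_poly_Euler_gf_def mult.commute)
  then show ?thesis
    by (simp only: mult.assoc [symmetric] Stirling_order_gf_mult_bernoulli_order_gf)
qed

theorem theorem6:
  fixes p q :: real and k :: int and n s :: nat and x :: "'a :: real_field"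
  assumes "0 < q" and "q < p" and "p \<le> 1"
  shows "pq_poly_Euler k p q n x =
    (\<Sum>l=0..n. of_nat (n choose l) * of_nat (Stirling (l + s) s) *
      (\<Sum>i=0..n-l. of_nat ((n - l) choose i) / of_nat ((l + s) choose s) *
         bernoulli_order s i x * pq_poly_Euler_number k p q (n - l - i)))"
proof -
  have "pq_poly_Euler k p q n x =
      (\<Sum>l=0..n. of_nat (n choose l) * (of_nat (Stirling (l + s) s) / of_nat ((l + s) choose s)) *
        (\<Sum>i=0..n-l. of_nat ((n - l) choose i) * bernoulli_order s i x *
           pq_poly_Euler_number k p q (n - l - i)))"
    \<comment> \<open>Decomposing only at \<open>x\<close> leaves the series at \<open>0\<close>
      intact; binomial convolution, applied twice, yields the nested sums.\<close>
    unfolding pq_poly_Euler_def [of k p q n x] pq_poly_Euler_gf_decompose [of k p q x s]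
      fact_mult_fps_mult_nth bernoulli_order_def pq_poly_Euler_def
    by (simp add: Stirling_order_gf_def)
  also have "\<dots> = (\<Sum>l=0..n. of_nat (n choose l) * of_nat (Stirling (l + s) s) *
      (\<Sum>i=0..n-l. of_nat ((n - l) choose i) / of_nat ((l + s) choose s) *
         bernoulli_order s i x * pq_poly_Euler_number k p q (n - l - i)))"
    by (simp add: sum_distrib_left mult_ac)
  finally show ?thesis .
qed

end
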